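(* Let $d\ge1$, $M>0$, and let $\mathbf F\in C^\infty([-M,M],\mathbb R^d)$. Suppose that for every $u\in[-M,M]$ there exists an integer $m\ge1$ such that $$\operatorname{rank}\{\mathbf F''(u),\dots,\mathbf F^{(m+1)}(u)\}=d .$$ Then for every $(\tau,\xi)\in\mathbb R\times\mathbb R^d$ with $\tau^2+|\xi|^2=1$ the set $$W(\tau,\xi)=\{v\in[-M,M]:\ \tau+\mathbf F'(v)\cdot\xi=0\}$$ has null Lebesgue measure. The converse can fail: there exists $\mathbf F\in C^\infty([-M,M],\mathbb R^d)$ such that $W(\tau,\xi)$ has null Lebesgue measure for every such $(\tau,\xi)$, but for some $u\in[-M,M]$ no integer $m\ge1$ satisfies $\operatorname{rank}\{\mathbf F''(u),\dots,\mathbf F^{(m+1)}(u)\}=d$.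
   Context: The rank of a finite set of vectors of $\mathbb R^d$ is the dimension of their span. Primes and superscripts $(k)$ denote derivatives in the scalar variable. *)

theory Defs
  imports "HOL-Analysis.Analysis"
begin

text \<open>Derivatives are taken within the closed interval, hence are one-sided at its endpoints.\<close>

primrec deriv_within :: "nat \<Rightarrow> real set \<Rightarrow> (real \<Rightarrow> 'a::real_normed_vector) \<Rightarrow> real \<Rightarrow> 'a" where
  "deriv_within 0 S F = F"
| "deriv_within (Suc k) S F = (\<lambda>u. vector_derivative (deriv_within k S F) (at u within S))"

definition smooth_within :: "real set \<Rightarrow> (real \<Rightarrow> 'a::real_normed_vector) \<Rightarrow> bool" where
  "smooth_within S F \<longleftrightarrow> (\<forall>k. deriv_within k S F differentiable_on S)"

definition full_rank_at :: "real \<Rightarrow> (real \<Rightarrow> real ^ 'd) \<Rightarrow> real \<Rightarrow> nat \<Rightarrow> bool" where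
  "full_rank_at M F u m \<longleftrightarrow>
     dim (span ((\<lambda>k. deriv_within k {-M..M} F u) ` {2..m + 1})) = CARD('d)"

definition W :: "real \<Rightarrow> (real \<Rightarrow> real ^ 'd) \<Rightarrow> real \<Rightarrow> real ^ 'd \<Rightarrow> real set" where
  "W M F \<tau> \<xi> = {v \<in> {-M..M}. \<tau> + deriv_within 1 {-M..M} F v \<bullet> \<xi> = 0}"

end

theory Submission
  imports Defs "HOL-Computational_Algebra.Polynomial"
begin

text \<open>
  If the derivatives of order at least two span the whole space at every point, then no derivative
  sequence of \<open>\<tau> + F'(v) \<bullet> \<xi>\<close> with \<open>\<xi> \<noteq> 0\<close> vanishes identically at a point. At a zero, let
  \<open>h\<^sub>j\<close> be the last derivative before the first nonvanishing one: the zero is then an isolated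
  zero of \<open>h\<^sub>j\<close>. As every set of reals has only countably many isolated points, the zero set is
  countable.

  For the converse, take \<open>F'\<close> with components \<open>exp (- c\<^sub>i / v\<^sup>2)\<close> for distinct positive
  integers \<open>c\<^sub>i\<close>. All its derivatives vanish at \<open>0\<close>, yet \<open>\<tau> + F'(v) \<bullet> \<xi>\<close> is for \<open>v \<noteq> 0\<close> a nonzero
  polynomial in \<open>exp (- 1 / v\<^sup>2)\<close>, so it has finitely many zeros.
\<close>

section \<open>Zeros of functions without points of infinite order\<close>

text \<open>Each isolated point has a basic open set meeting \<open>A\<close> in that point alone.
  Distinct points get distinct basic sets, and the base is countable.\<close>

lemma countable_isolated_points:
  fixes A :: "'a::second_countable_topology set"
  shows "countable {z \<in> A. \<not> z islimpt A}" (is "countable ?X")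
proof -
  obtain B :: "'a set set" where B: "countable B" "topological_basis B"
    using ex_countable_basis by auto
  have "\<exists>b\<in>B. z \<in> b \<and> A \<inter> b \<subseteq> {z}" if z: "z \<in> ?X" for z
  proof -
    obtain T where T: "open T" "z \<in> T" "A \<inter> T \<subseteq> {z}"
      using z by (auto simp: islimpt_def)
    obtain b where "b \<in> B" "z \<in> b" "b \<subseteq> T"
      using topological_basisE[OF B(2) T(1,2)] by metis
    with T show ?thesis by blast
  qed
  then obtain f where f: "\<And>z. z \<in> ?X \<Longrightarrow> f z \<in> B \<and> z \<in> f z \<and> A \<inter> f z \<subseteq> {z}"
    by metis
  have "inj_on f ?X"
  proof (rule inj_onI)
    fix x y assume "x \<in> ?X" "y \<in> ?X" "f x = f y"
    with f[of x] f[of y] show "x = y" by auto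
  qed
  moreover have "f ` ?X \<subseteq> B" using f by blast
  ultimately show ?thesis
    using B(1) countable_image_inj_on countable_subset by metis
qed

text \<open>Restricted to its zero set, \<open>f\<close> coincides with the zero function;
  derivatives within a set are unique at its limit points.\<close>

lemma limit_of_zeros_imp_deriv_zero:
  fixes f :: "real \<Rightarrow> real"
  assumes f: "(f has_real_derivative D) (at u within S)"
    and u: "u \<in> S" "f u = 0" "u islimpt {z \<in> S. f z = 0}" (is "u islimpt ?Z")
  shows "D = 0"
proof -
  have "(f has_real_derivative D) (at u within ?Z)"
    using f by (rule DERIV_subset) auto
  then have "((\<lambda>_. 0) has_real_derivative D) (at u within ?Z)"
    by (rule has_field_derivative_transform_within[where d = 1]) (use u in auto)
  then have "((\<lambda>_. 0) has_vector_derivative D) (at u within ?Z)"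
    by (simp add: has_real_derivative_iff_has_vector_derivative)
  moreover have "((\<lambda>_. 0) has_vector_derivative (0::real)) (at u within ?Z)"
    by simp
  ultimately show ?thesis
    using u(3) by (intro vector_derivative_unique_within) (auto simp: trivial_limit_within)
qed

text \<open>Taking the successive derivatives as an abstract sequence \<open>h\<close> leaves room
  for the constant \<tau> in its initial term.\<close>

lemma countable_zeros:
  fixes h :: "nat \<Rightarrow> real \<Rightarrow> real"
  assumes h: "\<And>k u. u \<in> S \<Longrightarrow> (h k has_real_derivative h (Suc k) u) (at u within S)"
    and nz: "\<And>u. u \<in> S \<Longrightarrow> \<exists>k. h k u \<noteq> 0"
  shows "countable {u \<in> S. h 0 u = 0}"
proof (rule countable_subset)
  define Z where "Z k = {u \<in> S. h k u = 0}" for k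
  show "{u \<in> S. h 0 u = 0} \<subseteq> (\<Union>k. {z \<in> Z k. \<not> z islimpt Z k})"
  proof
    fix u assume u: "u \<in> {u \<in> S. h 0 u = 0}"
    obtain k where k: "h k u \<noteq> 0" "\<And>j. j < k \<Longrightarrow> h j u = 0"
      using nz[of u] u exists_least_iff[of "\<lambda>k. h k u \<noteq> 0"] by auto
    then obtain j where j: "k = Suc j"
      using u by (cases k) auto
    then have "h j u = 0" "h (Suc j) u \<noteq> 0"
      using k by auto
    then have "u \<in> Z j" "\<not> u islimpt Z j"
      using u limit_of_zeros_imp_deriv_zero[OF h[of u j]] by (auto simp: Z_def)
    then show "u \<in> (\<Union>k. {z \<in> Z k. \<not> z islimpt Z k})" by blast
  qed
qed (intro countable_UN countable_isolated_points; simp)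

lemma countable_imp_null_set_lebesgue:
  fixes A :: "'a::euclidean_space set"
  assumes "countable A"
  shows "A \<in> null_sets lebesgue"
  using assms by (intro null_sets_completionI countable_imp_null_set_lborel)

section \<open>From full rank to null level sets\<close>

lemma smooth_within_deriv:
  assumes "smooth_within S F" "u \<in> S"
  shows "(deriv_within k S F has_vector_derivative deriv_within (Suc k) S F u) (at u within S)"
  using assms by (auto simp: smooth_within_def differentiable_on_def vector_derivative_works)

text \<open>Otherwise \<xi> would be orthogonal to a spanning set, hence to itself.\<close>

lemma full_rank_at_imp_nonorthogonal:
  fixes F :: "real \<Rightarrow> real ^ 'd"
  assumes "full_rank_at M F u m" "\<xi> \<noteq> 0"
  shows "\<exists>k\<ge>2. deriv_within k {-M..M} F u \<bullet> \<xi> \<noteq> 0"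
proof (rule ccontr)
  let ?A = "(\<lambda>k. deriv_within k {-M..M} F u) ` {2..m + 1}"
  assume "\<not> ?thesis"
  then have "orthogonal \<xi> x" if "x \<in> ?A" for x
    using that by (auto simp: orthogonal_def inner_commute)
  moreover have "dim ?A = DIM(real ^ 'd)"
    using assms(1) by (simp add: full_rank_at_def)
  then have "\<xi> \<in> span ?A"
    using dim_eq_full by blast
  ultimately have "orthogonal \<xi> \<xi>"
    using orthogonal_to_span by blast
  then show False
    using assms(2) by (simp add: orthogonal_def)
qed

lemma null_sets_W_of_full_rank:
  fixes F :: "real \<Rightarrow> real ^ 'd"
  assumes F: "smooth_within {-M..M} F"
    and rank: "\<forall>u\<in>{-M..M}. \<exists>m\<ge>1. full_rank_at M F u m"
    and nz: "\<tau>\<^sup>2 + (norm \<xi>)\<^sup>2 = 1"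
  shows "W M F \<tau> \<xi> \<in> null_sets lebesgue"
proof (cases "\<xi> = 0")
  case True
  then have "W M F \<tau> \<xi> = {}"
    using nz by (auto simp: W_def)
  then show ?thesis by simp
next
  case False
  let ?S = "{-M..M}"
  \<comment> \<open>Index \<open>k\<close> stands for the derivative of order \<open>k + 1\<close>
    of \<open>F\<close>, so \<open>h 0\<close> is the function defining \<open>W\<close>. The
    constant \<tau> disappears after one differentiation.\<close>
  define h where "h k u = (if k = 0 then \<tau> else 0) + deriv_within (Suc k) ?S F u \<bullet> \<xi>" for k u
  have "(h k has_real_derivative h (Suc k) u) (at u within ?S)" if u: "u \<in> ?S" for k u
  proof -
    have "((\<lambda>u. deriv_within (Suc k) ?S F u \<bullet> \<xi>) has_vector_derivative
            deriv_within (Suc (Suc k)) ?S F u \<bullet> \<xi>) (at u within ?S)"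
      by (rule bounded_linear.has_vector_derivative
          [OF bounded_linear_inner_left smooth_within_deriv[OF F u]])
    then show ?thesis
      unfolding h_def has_real_derivative_iff_has_vector_derivative[symmetric]
      by (auto intro!: derivative_eq_intros simp del: deriv_within.simps)
  qed
  moreover have "\<exists>k. h k u \<noteq> 0" if u: "u \<in> ?S" for u
  proof -
    obtain m where "full_rank_at M F u m"
      using rank u by blast
    then obtain k where "k \<ge> 2" "deriv_within k ?S F u \<bullet> \<xi> \<noteq> 0"
      using full_rank_at_imp_nonorthogonal False by blast
    then have "h (k - 1) u \<noteq> 0" by (simp add: h_def del: deriv_within.simps)
    then show ?thesis by blast
  qed
  ultimately have "countable {u \<in> ?S. h 0 u = 0}"
    by (rule countable_zeros)
  then show ?thesis
    by (simp add: h_def W_def countable_imp_null_set_lebesgue)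
qed

section \<open>Flat functions\<close>

text \<open>Substitute \<open>t = c / v\<^sup>2\<close>, which tends to infinity, and compare with
  \<open>t ^ n / exp t\<close>.\<close>

lemma tendsto_inverse_power_times_exp:
  fixes c :: real
  assumes "c > 0"
  shows "((\<lambda>v. inverse v ^ n * exp (- c / v\<^sup>2)) \<longlongrightarrow> 0) (at 0)"
proof (rule Lim_null_comparison)
  have "filterlim (\<lambda>v::real. v\<^sup>2) (at_right 0) (at 0)"
    unfolding filterlim_at by (auto intro!: tendsto_eq_intros simp: eventually_at intro: exI[of _ 1])
  then have "filterlim (\<lambda>v. c / v\<^sup>2) at_top (at 0)"
    unfolding divide_inverse
    by (intro filterlim_tendsto_pos_mult_at_top[OF tendsto_const assms]
          filterlim_compose[OF filterlim_inverse_at_top_right])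
  then have "((\<lambda>v. (c / v\<^sup>2) ^ n / exp (c / v\<^sup>2)) \<longlongrightarrow> 0) (at 0)"
    by (rule filterlim_compose[OF tendsto_power_div_exp_0])
  then show "((\<lambda>v. inverse c ^ n * ((c / v\<^sup>2) ^ n / exp (c / v\<^sup>2))) \<longlongrightarrow> 0) (at 0)"
    by (rule tendsto_mult_right_zero)
  have "norm (inverse v ^ n * exp (- c / v\<^sup>2)) \<le> inverse c ^ n * ((c / v\<^sup>2) ^ n / exp (c / v\<^sup>2))"
    if v: "v \<noteq> 0" "\<bar>v\<bar> < 1" for v :: real
  proof -
    \<comment> \<open>Since \<open>1 / v\<close> exceeds 1 in modulus, the exponent may be raised to
      the even number \<open>2 * n\<close>, which gives a power of
      \<open>c / v\<^sup>2\<close>.\<close>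
    have "1 \<le> inverse \<bar>v\<bar>"
      using v by (simp add: one_le_inverse)
    then have "inverse \<bar>v\<bar> ^ n \<le> inverse \<bar>v\<bar> ^ (2 * n)"
      by (intro power_increasing) auto
    also have "\<dots> = (inverse c * (c / v\<^sup>2)) ^ n"
    proof -
      have "(inverse \<bar>v\<bar>)\<^sup>2 = inverse c * (c / v\<^sup>2)"
        using assms by (simp add: field_simps)
      then show ?thesis by (simp only: power_mult)
    qed
    also have "\<dots> = inverse c ^ n * (c / v\<^sup>2) ^ n"
      by (rule power_mult_distrib)
    finally have "inverse \<bar>v\<bar> ^ n * exp (- c / v\<^sup>2) \<le> inverse c ^ n * (c / v\<^sup>2) ^ n * exp (- c / v\<^sup>2)"
      by (rule mult_right_mono) simp
    then show ?thesis
      by (simp add: abs_mult power_abs exp_minus divide_inverse)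
  qed
  then show "\<forall>\<^sub>F v in at 0. norm (inverse v ^ n * exp (- c / v\<^sup>2))
      \<le> inverse c ^ n * ((c / v\<^sup>2) ^ n / exp (c / v\<^sup>2))"
    unfolding eventually_at by (intro exI[of _ 1]) (auto simp: dist_real_def)
qed

lemma tendsto_poly_inverse_times_exp:
  fixes c :: real
  assumes "c > 0"
  shows "((\<lambda>v. poly p (inverse v) * exp (- c / v\<^sup>2)) \<longlongrightarrow> 0) (at 0)"
  unfolding poly_altdef sum_distrib_right mult.assoc
  by (intro tendsto_null_sum tendsto_mult_right_zero tendsto_inverse_power_times_exp assms)

text \<open>A class closed under differentiation: only the polynomial in \<open>1 / v\<close>
  changes, the exponential factor stays. The value at 0 is the limit there when
  \<open>c > 0\<close>.\<close>

definition flat :: "real \<Rightarrow> real poly \<Rightarrow> real \<Rightarrow> real" where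
  "flat c p v = (if v = 0 then 0 else poly p (inverse v) * exp (- c / v\<^sup>2))"

text \<open>In \<open>x = 1 / v\<close>, the derivative of \<open>p(x) exp (- c x\<^sup>2)\<close> is \<open>(2 c x\<^sup>3 p(x) - x\<^sup>2 p'(x)) exp (- c x\<^sup>2)\<close>.\<close>

definition flat_deriv :: "real \<Rightarrow> real poly \<Rightarrow> real poly" where
  "flat_deriv c p = monom (2 * c) 3 * p - monom 1 2 * pderiv p"

lemma flat_has_derivative:
  assumes "c > 0"
  shows "(flat c p has_real_derivative flat c (flat_deriv c p) v) (at v)"
proof (cases "v = 0")
  case True
  have "((\<lambda>h. flat c p h / h) \<longlongrightarrow> 0) (at 0)"
  proof (rule Lim_transform_eventually)
    \<comment> \<open>\<open>pCons 0 p\<close> is \<open>p\<close> times the variable, so the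
      division by \<open>v\<close> in the difference quotient is absorbed into the
      polynomial.\<close>
    show "((\<lambda>v. poly (pCons 0 p) (inverse v) * exp (- c / v\<^sup>2)) \<longlongrightarrow> 0) (at 0)"
      by (rule tendsto_poly_inverse_times_exp[OF assms])
    show "\<forall>\<^sub>F v in at 0. poly (pCons 0 p) (inverse v) * exp (- c / v\<^sup>2) = flat c p v / v"
      unfolding eventually_at by (intro exI[of _ 1]) (auto simp: flat_def divide_inverse)
  qed
  with True show ?thesis
    by (simp add: DERIV_def flat_def)
next
  case False
  have "((\<lambda>v. poly p (inverse v)) has_real_derivative
          poly (pderiv p) (inverse v) * - (inverse v)\<^sup>2) (at v)"
    using False by (intro DERIV_chain2[OF poly_DERIV])
      (auto intro!: derivative_eq_intros simp: power2_eq_square)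
  moreover have "((\<lambda>v. - c / v\<^sup>2) has_real_derivative 2 * c * inverse v ^ 3) (at v)"
    using False by (auto intro!: derivative_eq_intros simp: field_simps eval_nat_numeral)
  then have "((\<lambda>v. exp (- c / v\<^sup>2)) has_real_derivative
          exp (- c / v\<^sup>2) * (2 * c * inverse v ^ 3)) (at v)"
    by (rule DERIV_chain2[OF DERIV_exp])
  ultimately have "((\<lambda>v. poly p (inverse v) * exp (- c / v\<^sup>2)) has_real_derivative
      poly (pderiv p) (inverse v) * - (inverse v)\<^sup>2 * exp (- c / v\<^sup>2) +
      exp (- c / v\<^sup>2) * (2 * c * inverse v ^ 3) * poly p (inverse v)) (at v)"
    by (rule DERIV_mult)
  also have "poly (pderiv p) (inverse v) * - (inverse v)\<^sup>2 * exp (- c / v\<^sup>2) +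
      exp (- c / v\<^sup>2) * (2 * c * inverse v ^ 3) * poly p (inverse v) = flat c (flat_deriv c p) v"
    using False by (simp add: flat_def flat_deriv_def poly_monom algebra_simps)
  finally have "((\<lambda>v. poly p (inverse v) * exp (- c / v\<^sup>2)) has_real_derivative
      flat c (flat_deriv c p) v) (at v)" .
  then show ?thesis
    by (rule has_field_derivative_transform_within_open[where S = "- {0}"])
       (use False in \<open>auto simp: flat_def\<close>)
qed

text \<open>For positive \<open>c\<close>, this is the derivative of order \<open>k\<close> of the
  curve with components \<open>exp (- c i / v\<^sup>2)\<close>. Natural exponents make its level
  sets polynomial in \<open>exp (- 1 / v\<^sup>2)\<close>.\<close>

definition flat_curve :: "('d \<Rightarrow> nat) \<Rightarrow> nat \<Rightarrow> real \<Rightarrow> real ^ 'd" where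
  "flat_curve c k v = (\<chi> i. flat (real (c i)) ((flat_deriv (real (c i)) ^^ k) 1) v)"

lemma has_vector_derivative_vec_lambda:
  fixes f :: "real \<Rightarrow> 'd::finite \<Rightarrow> real"
  assumes "\<And>i. ((\<lambda>x. f x i) has_real_derivative f' i) (at x within S)"
  shows "((\<lambda>x. \<chi> i. f x i) has_vector_derivative (\<chi> i. f' i)) (at x within S)"
  using assms
  unfolding has_vector_derivative_def has_derivative_componentwise_within[where 'b = "real ^ 'd"]
  by (auto simp: Basis_vec_def inner_axis has_field_derivative_def mult.commute[of _ "f' _"])

lemma flat_curve_has_derivative:
  assumes "\<And>i. c i > 0"
  shows "(flat_curve c k has_vector_derivative flat_curve c (Suc k) v) (at v within S)"
proof -
  have "((\<lambda>v. \<chi> i. flat (real (c i)) ((flat_deriv (real (c i)) ^^ k) 1) v) has_vector_derivative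
         (\<chi> i. flat (real (c i)) ((flat_deriv (real (c i)) ^^ Suc k) 1) v)) (at v within S)"
    using assms
    by (intro has_vector_derivative_vec_lambda)
       (simp add: has_field_derivative_at_within[OF flat_has_derivative])
  then show ?thesis
    by (simp only: flat_curve_def[abs_def])
qed

lemma flat_curve_at_0 [simp]: "flat_curve c k 0 = 0"
  by (simp add: flat_curve_def flat_def vec_eq_iff)

lemma flat_curve_level_set_finite:
  fixes c :: "'d::finite \<Rightarrow> nat"
  assumes c: "inj c" "\<And>i. c i > 0" and nz: "\<tau> \<noteq> 0 \<or> \<xi> \<noteq> 0"
  shows "finite {v. \<tau> + flat_curve c 0 v \<bullet> \<xi> = 0}"
proof -
  \<comment> \<open>As the exponents \<open>c i\<close> are distinct and positive, no two of the
    terms merge: \<tau> and the components of \<xi> are all coefficients of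
    \<open>P\<close>.\<close>
  define P where "P = [:\<tau>:] + (\<Sum>i\<in>UNIV. monom (\<xi> $ i) (c i))"
  have "coeff P 0 = \<tau>"
    using c(2) by (simp add: P_def coeff_sum less_imp_neq[symmetric])
  moreover have "coeff P (c j) = \<xi> $ j" for j
    using c by (simp add: P_def coeff_sum coeff_pCons inj_eq if_distrib split: nat.split cong: if_cong)
       (metis less_irrefl)
  ultimately have "P \<noteq> 0"
    using nz by (auto simp: vec_eq_iff)
  have poly_P: "\<tau> + flat_curve c 0 v \<bullet> \<xi> = poly P (exp (- 1 / v\<^sup>2))" if "v \<noteq> 0" for v
    using that by (simp add: P_def flat_curve_def flat_def inner_vec_def poly_sum poly_monom
        exp_of_nat_mult[symmetric] mult.commute)
  have "{v. \<tau> + flat_curve c 0 v \<bullet> \<xi> = 0} \<subseteq>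
      insert 0 (\<Union>r\<in>{r. poly P r = 0}. {sqrt (- 1 / ln r), - sqrt (- 1 / ln r)})"
  proof
    fix v assume v: "v \<in> {v. \<tau> + flat_curve c 0 v \<bullet> \<xi> = 0}"
    have "v = sqrt (- 1 / ln (exp (- 1 / v\<^sup>2))) \<or> v = - sqrt (- 1 / ln (exp (- 1 / v\<^sup>2)))"
      by (auto simp: abs_if)
    with v poly_P[of v] show "v \<in> insert 0 (\<Union>r\<in>{r. poly P r = 0}. {sqrt (- 1 / ln r), - sqrt (- 1 / ln r)})"
      by (cases "v = 0") auto
  qed
  then show ?thesis
    by (rule finite_subset) (auto simp: poly_roots_finite[OF \<open>P \<noteq> 0\<close>])
qed

section \<open>Iterated derivatives on an interval and the counterexample\<close>

text \<open>Induction on \<open>k\<close>; \<open>a < b\<close> makes derivatives within the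
  interval unique, also at the endpoints.\<close>

lemma deriv_within_eqI:
  fixes H :: "nat \<Rightarrow> real \<Rightarrow> 'a::real_normed_vector"
  assumes ab: "a < b" and u: "u \<in> {a..b}"
    and H: "\<And>k v. v \<in> {a..b} \<Longrightarrow> (H k has_vector_derivative H (Suc k) v) (at v within {a..b})"
  shows "deriv_within k {a..b} (H 0) u = H k u"
  using u
proof (induction k arbitrary: u)
  case (Suc k)
  have "(deriv_within k {a..b} (H 0) has_vector_derivative H (Suc k) u) (at u within {a..b})"
    using has_vector_derivative_transform[OF Suc.prems _ H[OF Suc.prems]] Suc.IH by metis
  then show ?case
    using vector_derivative_within_cbox[of a b u] ab Suc.prems by simp
qed simp

lemma smooth_withinI:
  fixes H :: "nat \<Rightarrow> real \<Rightarrow> 'a::real_normed_vector"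
  assumes "a < b"
    and H: "\<And>k v. v \<in> {a..b} \<Longrightarrow> (H k has_vector_derivative H (Suc k) v) (at v within {a..b})"
  shows "smooth_within {a..b} (H 0)"
  unfolding smooth_within_def
proof
  fix k
  show "deriv_within k {a..b} (H 0) differentiable_on {a..b}"
    unfolding differentiable_on_def
  proof
    fix u assume u: "u \<in> {a..b}"
    have "(deriv_within k {a..b} (H 0) has_vector_derivative H (Suc k) u) (at u within {a..b})"
      using has_vector_derivative_transform[OF u _ H[OF u]] deriv_within_eqI[where H = H, OF assms(1) _ H] by metis
    then show "deriv_within k {a..b} (H 0) differentiable at u within {a..b}"
      by (rule differentiableI_vector)
  qed
qed

lemma exists_flat_counterexample:
  fixes M :: real
  assumes "M > 0"
  shows "\<exists>F :: real \<Rightarrow> real ^ 'd. smooth_within {-M..M} F \<and>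
      (\<forall>\<tau> \<xi>. \<tau>\<^sup>2 + (norm \<xi>)\<^sup>2 = 1 \<longrightarrow> W M F \<tau> \<xi> \<in> null_sets lebesgue) \<and>
      (\<exists>u\<in>{-M..M}. \<not> (\<exists>m\<ge>1. full_rank_at M F u m))"
proof -
  obtain e :: "'d \<Rightarrow> nat" where "inj e"
    using finite_imp_inj_to_nat_seg[of "UNIV :: 'd set"] by auto
  \<comment> \<open>The successor keeps every exponent positive, as both flatness and the constant
    coefficient of \<open>P\<close> require.\<close>
  define c where "c i = Suc (e i)" for i
  have c: "inj c" "\<And>i. c i > 0"
    using \<open>inj e\<close> by (auto simp: c_def inj_def)
  \<comment> \<open>The curve sought is the antiderivative \<open>H 0\<close>, so that
    \<open>F'\<close> is the flat curve and all orders are shifted by one.\<close>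
  define H where "H k = (case k of 0 \<Rightarrow> \<lambda>v. integral {-M..v} (flat_curve c 0) | Suc j \<Rightarrow> flat_curve c j)" for k
  have cont: "continuous_on {-M..M} (flat_curve c 0)"
    using flat_curve_has_derivative[OF c(2)] by (rule continuous_on_vector_derivative)
  have H: "(H k has_vector_derivative H (Suc k) v) (at v within {-M..M})" if "v \<in> {-M..M}" for k v
    using integral_has_vector_derivative[OF cont that] flat_curve_has_derivative[OF c(2)]
    by (cases k) (auto simp: H_def)
  have ab: "-M < M" using assms by simp
  note deriv = deriv_within_eqI[where H = H, OF ab _ H]
  have "W M (H 0) \<tau> \<xi> \<in> null_sets lebesgue" if "\<tau>\<^sup>2 + (norm \<xi>)\<^sup>2 = 1" for \<tau> \<xi>
  proof -
    have "\<tau> \<noteq> 0 \<or> \<xi> \<noteq> 0" using that by auto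
    moreover have "W M (H 0) \<tau> \<xi> \<subseteq> {v. \<tau> + flat_curve c 0 v \<bullet> \<xi> = 0}"
      using deriv[where k = 1] by (auto simp: W_def H_def simp del: deriv_within.simps)
    ultimately show ?thesis
      using flat_curve_level_set_finite[OF c] countable_imp_null_set_lebesgue
      by (meson countable_finite finite_subset)
  qed
  moreover have "\<not> full_rank_at M (H 0) 0 m" for m
  proof -
    have "deriv_within k {-M..M} (H 0) 0 = 0" if "k \<ge> 2" for k
      using deriv[of 0 k] that assms by (cases k) (auto simp: H_def simp del: deriv_within.simps)
    then have "(\<lambda>k. deriv_within k {-M..M} (H 0) 0) ` {2..m + 1} \<subseteq> {0}"
      by auto
    then have "dim ((\<lambda>k. deriv_within k {-M..M} (H 0) 0) ` {2..m + 1}) = 0"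
      by (simp only: dim_eq_0)
    then show ?thesis
      \<comment> \<open>The rank is 0, while \<open>CARD('d)\<close> is positive.\<close>
      unfolding full_rank_at_def dim_span by (simp only:) simp
  qed
  moreover have "0 \<in> {-M..M}"
    using assms by simp
  ultimately show ?thesis
    using smooth_withinI[where H = H, OF ab H] by blast
qed

theorem proposition3p1:
  fixes M :: real
  assumes "M > 0"
  shows "(\<forall>F :: real \<Rightarrow> real ^ 'd.
            smooth_within {-M..M} F \<longrightarrow>
            (\<forall>u\<in>{-M..M}. \<exists>m\<ge>1. full_rank_at M F u m) \<longrightarrow>
            (\<forall>\<tau> \<xi>. \<tau>\<^sup>2 + (norm \<xi>)\<^sup>2 = 1 \<longrightarrow> W M F \<tau> \<xi> \<in> null_sets lebesgue))
       \<and> (\<exists>F :: real \<Rightarrow> real ^ 'd.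
            smooth_within {-M..M} F \<and>
            (\<forall>\<tau> \<xi>. \<tau>\<^sup>2 + (norm \<xi>)\<^sup>2 = 1 \<longrightarrow> W M F \<tau> \<xi> \<in> null_sets lebesgue) \<and>
            (\<exists>u\<in>{-M..M}. \<not> (\<exists>m\<ge>1. full_rank_at M F u m)))"
  by (intro conjI exists_flat_counterexample assms allI impI null_sets_W_of_full_rank)

end
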